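(* Let $n\geq 3$. Then $q^{p}_3(n)=n/2+1$ if $n$ is even, and $q^{p}_3(n)=\lfloor n/2\rfloor$ if $n$ is odd.
   Context: There are $n$ balls with distinct identities, each colored with one of two colors; the coloring is unknown to a questioner. A color is the majority color if strictly more than half of the balls have it. The majority problem is: determine with certainty whether a majority color exists, and if it does, output a ball of the majority color. The questioner may adaptively ask triple queries in the Pairing model: choose a set of $3$ distinct balls; the answer is YES if all three have the same color, and otherwise NO together with two of the three balls that have different colors (the oracle chooses which such pair; answers are consistent with the hidden coloring and may be adversarial). $q^{p}_3(n)$ denotes the minimum number of such queries that suffice in the worst case to solve the majority problem for $n$ balls. *)

theory Defs
  imports Main
begin

text \<open>
  The balls are \<open>{..<n}\<close>; a colouring is a function \<open>c :: nat \<Rightarrow> bool\<close>, whose values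
  outside \<open>{..<n}\<close> are irrelevant.
\<close>

definition is_majority_color :: "nat \<Rightarrow> (nat \<Rightarrow> bool) \<Rightarrow> bool \<Rightarrow> bool" where
  "is_majority_color n c k \<longleftrightarrow> 2 * card {i. i < n \<and> c i = k} > n"

text \<open>The output \<open>None\<close> is the claim that there is no majority colour.\<close>

fun correct_output :: "nat \<Rightarrow> (nat \<Rightarrow> bool) \<Rightarrow> nat option \<Rightarrow> bool" where
  "correct_output n c None \<longleftrightarrow> \<not> (\<exists>k. is_majority_color n c k)"
| "correct_output n c (Some b) \<longleftrightarrow> b < n \<and> is_majority_color n c (c b)"

text \<open>\<open>No P\<close> is the answer NO together with the two-element set \<open>P\<close> of balls shown.\<close>

datatype answer = Yes | No "nat set"

definition possible_answer :: "(nat \<Rightarrow> bool) \<Rightarrow> nat set \<Rightarrow> answer \<Rightarrow> bool" where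
  "possible_answer c Q a \<longleftrightarrow>
     (a = Yes \<and> (\<forall>x\<in>Q. \<forall>y\<in>Q. c x = c y)) \<or>
     (\<exists>x\<in>Q. \<exists>y\<in>Q. c x \<noteq> c y \<and> a = No {x, y})"

text \<open>
  An adaptive strategy is a decision tree. Trees have no infinite branches, so every
  play of a strategy ends with an output.
\<close>

datatype strategy = Output "nat option" | Ask "nat set" "answer \<Rightarrow> strategy"

primrec triple_queries :: "nat \<Rightarrow> strategy \<Rightarrow> bool" where
  "triple_queries n (Output r) \<longleftrightarrow> True"
| "triple_queries n (Ask Q f) \<longleftrightarrow> Q \<subseteq> {..<n} \<and> card Q = 3 \<and> (\<forall>a. triple_queries n (f a))"

text \<open>
  \<open>play c t m r\<close>: for the hidden colouring \<open>c\<close> and some choice of the oracle's answers,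
  strategy \<open>t\<close> asks exactly \<open>m\<close> queries and then outputs \<open>r\<close>.
\<close>

inductive play :: "(nat \<Rightarrow> bool) \<Rightarrow> strategy \<Rightarrow> nat \<Rightarrow> nat option \<Rightarrow> bool"
  for c :: "nat \<Rightarrow> bool" where
  play_Output: "play c (Output r) 0 r"
| play_Ask: "possible_answer c Q a \<Longrightarrow> play c (f a) m r \<Longrightarrow> play c (Ask Q f) (Suc m) r"

definition solves_majority_within :: "nat \<Rightarrow> nat \<Rightarrow> strategy \<Rightarrow> bool" where
  "solves_majority_within n k t \<longleftrightarrow>
     triple_queries n t \<and> (\<forall>c m r. play c t m r \<longrightarrow> m \<le> k \<and> correct_output n c r)"

definition q3_pairing :: "nat \<Rightarrow> nat" where
  "q3_pairing n = (LEAST k. \<exists>t. solves_majority_within n k t)"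

end

theory Submission
  imports Defs
begin

text \<open>
  Lower bound: the answers tie the balls together into components, and the adversary keeps the two
  colours within every component balanced up to one ball. A query then cancels at most two
  unbalanced components, and the outcome is open while two of them remain. For even \<open>n\<close> the
  adversary can moreover answer some query without cancelling anything.

  Upper bound: ask triples of single balls. A NO discards a balanced pair, a YES forms a
  monochromatic group of three, and either way two units disappear. The at most two leftover units
  weigh less than one group, so the problem repeats with the groups as units; the leftovers
  matter only when the groups tie. Comparing two leftover groups takes one query, because a group
  has two balls of equal colour; for even \<open>n\<close> comparing two leftover single balls takes two.
\<close>

section \<open>Signed counts of colours\<close>

definition color_sign :: "bool \<Rightarrow> int" where
  "color_sign b = (if b then 1 else - 1)"

definition tally :: "(nat \<Rightarrow> bool) \<Rightarrow> nat set \<Rightarrow> int" where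
  "tally c A = (\<Sum>i\<in>A. color_sign (c i))"

lemma color_sign_simps [simp]: "color_sign True = 1" "color_sign False = - 1"
  by (simp_all add: color_sign_def)

lemma tally_empty [simp]: "tally c {} = 0"
  by (simp add: tally_def)

lemma tally_insert [simp]:
  "finite A \<Longrightarrow> a \<notin> A \<Longrightarrow> tally c (insert a A) = color_sign (c a) + tally c A"
  by (simp add: tally_def)

lemma abs_tally_le_card: "\<bar>tally c A\<bar> \<le> int (card A)"
proof -
  have "\<bar>tally c A\<bar> \<le> (\<Sum>i\<in>A. \<bar>color_sign (c i)\<bar>)"
    unfolding tally_def by (rule sum_abs)
  also have "\<dots> = int (card A)"
    by (simp add: color_sign_def if_distrib cong: if_cong)
  finally show ?thesis .
qed

text \<open>Multiplying by \<open>color_sign k\<close> turns the sum into the number of balls of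
  colour \<open>k\<close> minus the number of the others.\<close>

lemma is_majority_color_iff_tally:
  "is_majority_color n c k \<longleftrightarrow> color_sign k * tally c {..<n} > 0"
proof -
  let ?T = "{i. i < n \<and> c i = k}" and ?F = "{i. i < n \<and> c i \<noteq> k}"
  have split: "{..<n} = ?T \<union> ?F" by auto
  have "n = card (?T \<union> ?F)" using split by (metis card_lessThan)
  also have "\<dots> = card ?T + card ?F" by (rule card_Un_disjoint) auto
  finally have n: "n = card ?T + card ?F" .
  have "color_sign k * tally c {..<n} = (\<Sum>i\<in>?T \<union> ?F. color_sign k * color_sign (c i))"
    unfolding tally_def sum_distrib_left split[symmetric] by (rule refl)
  also have "\<dots> = (\<Sum>i\<in>?T. color_sign k * color_sign (c i)) + (\<Sum>i\<in>?F. color_sign k * color_sign (c i))"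
    by (rule sum.union_disjoint) auto
  also have "(\<Sum>i\<in>?T. color_sign k * color_sign (c i)) = (\<Sum>i\<in>?T. 1)"
    by (rule sum.cong) (auto simp: color_sign_def)
  also have "(\<Sum>i\<in>?F. color_sign k * color_sign (c i)) = (\<Sum>i\<in>?F. - 1)"
    by (rule sum.cong) (auto simp: color_sign_def)
  finally have "color_sign k * tally c {..<n} = int (card ?T) - int (card ?F)" by simp
  then show ?thesis unfolding is_majority_color_def using n by linarith
qed

lemma correct_output_None_iff: "correct_output n c None \<longleftrightarrow> tally c {..<n} = 0"
  by (auto simp: is_majority_color_iff_tally ex_bool_eq)

lemma correct_output_Some_iff:
  "correct_output n c (Some b) \<longleftrightarrow> b < n \<and> color_sign (c b) * tally c {..<n} > 0"
  by (simp add: is_majority_color_iff_tally)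

section \<open>The adversary\<close>

text \<open>
  The adversary's state is a labelling \<open>L\<close> of the balls by components and a reference colouring
  \<open>s\<close>: the answers given so far fix the colouring on each component up to exchanging the colours.
\<close>

definition consistent :: "(nat \<Rightarrow> nat) \<Rightarrow> (nat \<Rightarrow> bool) \<Rightarrow> (nat \<Rightarrow> bool) \<Rightarrow> bool" where
  "consistent L s c \<longleftrightarrow> (\<forall>i j. L i = L j \<longrightarrow> (c i = c j \<longleftrightarrow> s i = s j))"

definition weight :: "nat \<Rightarrow> (nat \<Rightarrow> nat) \<Rightarrow> (nat \<Rightarrow> bool) \<Rightarrow> nat \<Rightarrow> int" where
  "weight n L s l = tally s {i. i < n \<and> L i = l}"

definition balanced :: "nat \<Rightarrow> (nat \<Rightarrow> nat) \<Rightarrow> (nat \<Rightarrow> bool) \<Rightarrow> bool" where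
  "balanced n L s \<longleftrightarrow> (\<forall>l. \<bar>weight n L s l\<bar> \<le> 1)"

text \<open>In a balanced state these are exactly the components with an odd number of balls below
  \<open>n\<close>.\<close>

definition heavy :: "nat \<Rightarrow> (nat \<Rightarrow> nat) \<Rightarrow> (nat \<Rightarrow> bool) \<Rightarrow> nat set" where
  "heavy n L s = {l. weight n L s l \<noteq> 0}"

definition join_label :: "(nat \<Rightarrow> nat) \<Rightarrow> nat \<Rightarrow> nat \<Rightarrow> nat \<Rightarrow> nat" where
  "join_label L x y i = (if L i = L y then L x else L i)"

text \<open>The component of \<open>y\<close> is recoloured so that \<open>x\<close> and \<open>y\<close> agree iff \<open>d\<close> holds.\<close>

definition join_color :: "(nat \<Rightarrow> nat) \<Rightarrow> (nat \<Rightarrow> bool) \<Rightarrow> nat \<Rightarrow> nat \<Rightarrow> bool \<Rightarrow> nat \<Rightarrow> bool" where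
  "join_color L s x y d i = (if L i = L y then s i = ((s x = s y) = d) else s i)"

lemma heavy_subset: "heavy n L s \<subseteq> L ` {..<n}"
proof
  fix l assume "l \<in> heavy n L s"
  then have "{i. i < n \<and> L i = l} \<noteq> {}" by (auto simp only: heavy_def weight_def tally_empty)
  then show "l \<in> L ` {..<n}" by auto
qed

lemma finite_heavy [simp]: "finite (heavy n L s)"
  by (rule finite_subset[OF heavy_subset]) simp

text \<open>The component of \<open>y\<close> is flipped as a whole or not at all, so colour
  relations inside old components survive, and the merge adds only the relation of \<open>x\<close>
  to \<open>y\<close>. This is what justifies an answer given together with a merge.\<close>

lemma consistent_join:
  assumes "consistent (join_label L x y) (join_color L s x y d) c" "L x \<noteq> L y"
  shows "consistent L s c" "c x = c y \<longleftrightarrow> d"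
proof -
  let ?L = "join_label L x y" and ?s = "join_color L s x y d"
  have eq: "c i = c j \<longleftrightarrow> ?s i = ?s j" if "?L i = ?L j" for i j
    using assms(1) that unfolding consistent_def by blast
  show "consistent L s c"
    unfolding consistent_def
  proof (intro allI impI)
    fix i j assume ij: "L i = L j"
    have "?s i = ?s j \<longleftrightarrow> s i = s j"
      unfolding join_color_def ij by (cases "s i"; cases "s j"; simp)
    moreover have "?L i = ?L j" by (simp add: join_label_def ij)
    ultimately show "c i = c j \<longleftrightarrow> s i = s j" by (simp only: eq)
  qed
  have "?L x = ?L y" by (simp add: join_label_def)
  moreover have "?s x = ?s y \<longleftrightarrow> d"
    using assms(2) by (cases "s x"; cases "s y"; cases d; simp add: join_color_def)
  ultimately show "c x = c y \<longleftrightarrow> d" by (simp only: eq)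
qed

text \<open>The condition \<open>(s x = s y) = d\<close> says that the component of \<open>y\<close>
  keeps its colours, so it yields the sign with which that weight enters.\<close>

lemma weight_join:
  assumes "L x \<noteq> L y"
  shows "weight n (join_label L x y) (join_color L s x y d) l =
    (if l = L y then 0
     else if l = L x
     then weight n L s (L x) + color_sign ((s x = s y) = d) * weight n L s (L y)
     else weight n L s l)"
proof -
  let ?L = "join_label L x y" and ?s = "join_color L s x y d"
  consider "l = L y" | "l = L x" "l \<noteq> L y" | "l \<noteq> L x" "l \<noteq> L y" by blast
  then show ?thesis
  proof cases
    case 1
    then have "{i. i < n \<and> ?L i = l} = {}" using assms by (auto simp: join_label_def)
    then have "weight n ?L ?s l = 0" unfolding weight_def by (simp only: tally_empty)
    then show ?thesis using 1 by simp
  next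
    case 2
    let ?A = "{i. i < n \<and> L i = L x}" and ?B = "{i. i < n \<and> L i = L y}"
    have "{i. i < n \<and> ?L i = l} = ?A \<union> ?B" using 2 by (auto simp: join_label_def)
    moreover have "tally ?s (?A \<union> ?B) = tally ?s ?A + tally ?s ?B"
      unfolding tally_def using assms by (intro sum.union_disjoint) auto
    moreover have "tally ?s ?A = tally s ?A"
      unfolding tally_def using assms by (intro sum.cong) (auto simp: join_color_def)
    moreover have "tally ?s ?B = color_sign ((s x = s y) = d) * tally s ?B"
      unfolding tally_def sum_distrib_left
      by (intro sum.cong) (auto simp: join_color_def color_sign_def)
    ultimately show ?thesis using 2 by (simp add: weight_def)
  next
    case 3
    then have "{i. i < n \<and> ?L i = l} = {i. i < n \<and> L i = l}" by (auto simp: join_label_def)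
    moreover have "tally ?s {i. i < n \<and> L i = l} = tally s {i. i < n \<and> L i = l}"
      unfolding tally_def using 3 by (intro sum.cong) (auto simp: join_color_def)
    ultimately show ?thesis using 3 by (simp add: weight_def)
  qed
qed

text \<open>The function \<open>h\<close> tells which components keep their reference colours and
  which are flipped; all such colourings are consistent.\<close>

lemma tally_consistent:
  "tally (\<lambda>i. s i = h (L i)) {..<n} = (\<Sum>l\<in>L ` {..<n}. color_sign (h l) * weight n L s l)"
proof -
  have "tally (\<lambda>i. s i = h (L i)) {..<n} =
      (\<Sum>l\<in>L ` {..<n}. \<Sum>i\<in>{i. i \<in> {..<n} \<and> L i = l}. color_sign (s i = h (L i)))"
    unfolding tally_def by (rule sum.image_gen) simp
  also have "\<dots> = (\<Sum>l\<in>L ` {..<n}. color_sign (h l) * weight n L s l)"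
    unfolding weight_def tally_def sum_distrib_left
    by (intro sum.cong) (auto simp: color_sign_def)
  finally show ?thesis .
qed

lemma sum_abs_weight:
  assumes "balanced n L s"
  shows "(\<Sum>l\<in>L ` {..<n} - B. \<bar>weight n L s l\<bar>) = int (card (heavy n L s - B))"
proof -
  have "(\<Sum>l\<in>L ` {..<n} - B. \<bar>weight n L s l\<bar>) = (\<Sum>l\<in>heavy n L s - B. \<bar>weight n L s l\<bar>)"
    using heavy_subset[of n L s] by (intro sum.mono_neutral_right) (auto simp: heavy_def)
  also have "\<dots> = (\<Sum>l\<in>heavy n L s - B. 1)"
  proof (rule sum.cong)
    fix l assume "l \<in> heavy n L s - B"
    then have "weight n L s l \<noteq> 0" "\<bar>weight n L s l\<bar> \<le> 1"
      using assms by (auto simp: heavy_def balanced_def)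
    then show "\<bar>weight n L s l\<bar> = 1" by linarith
  qed simp
  finally show ?thesis by simp
qed

text \<open>Turning all weights to the same side refutes the claim of no majority. A named ball
  gains at most one from its own component, and some other heavy component can vote against
  it.\<close>

lemma consistent_incorrect_output:
  assumes bal: "balanced n L s" and two: "card (heavy n L s) \<ge> 2"
  shows "\<exists>c. consistent L s c \<and> \<not> correct_output n c r"
proof (cases r)
  case None
  let ?h = "\<lambda>l. weight n L s l \<ge> 0"
  let ?c = "\<lambda>i. s i = ?h (L i)"
  have "tally ?c {..<n} = (\<Sum>l\<in>L ` {..<n}. color_sign (?h l) * weight n L s l)"
    by (rule tally_consistent)
  also have "\<dots> = (\<Sum>l\<in>L ` {..<n} - {}. \<bar>weight n L s l\<bar>)"
    by (intro sum.cong) (auto simp: color_sign_def)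
  also have "\<dots> = int (card (heavy n L s))" using sum_abs_weight[OF bal, of "{}"] by simp
  finally have "\<not> correct_output n ?c r"
    using None two by (simp only: correct_output_None_iff)
  moreover have "consistent L s ?c" by (auto simp: consistent_def)
  ultimately show ?thesis by blast
next
  case (Some b)
  show ?thesis
  proof (cases "b < n")
    case False
    moreover have "consistent L s s" by (simp add: consistent_def)
    ultimately show ?thesis using Some by auto
  next
    case True
    \<comment> \<open>Every heavy component other than that of \<open>b\<close> votes against \<open>b\<close>.\<close>
    let ?h = "\<lambda>l. if l = L b then s b else weight n L s l < 0"
    let ?c = "\<lambda>i. s i = ?h (L i)"
    have "tally ?c {..<n} = (\<Sum>l\<in>L ` {..<n}. color_sign (?h l) * weight n L s l)"
      by (rule tally_consistent)
    also have "\<dots> = color_sign (s b) * weight n L s (L b) +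
        (\<Sum>l\<in>L ` {..<n} - {L b}. color_sign (?h l) * weight n L s l)"
      using True by (subst sum.remove[of _ "L b"]) auto
    also have "(\<Sum>l\<in>L ` {..<n} - {L b}. color_sign (?h l) * weight n L s l) =
        (\<Sum>l\<in>L ` {..<n} - {L b}. - \<bar>weight n L s l\<bar>)"
      by (intro sum.cong) (auto simp: color_sign_def)
    also have "\<dots> = - int (card (heavy n L s - {L b}))"
      unfolding sum_negf using sum_abs_weight[OF bal] by simp
    finally have "tally ?c {..<n} =
        color_sign (s b) * weight n L s (L b) - int (card (heavy n L s - {L b}))" by simp
    moreover have "card (heavy n L s - {L b}) \<ge> 1" using two by (auto simp: card_Diff_singleton_if)
    moreover have "\<bar>weight n L s (L b)\<bar> \<le> 1" using bal by (simp add: balanced_def)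
    then have "color_sign (s b) * weight n L s (L b) \<le> 1" by (auto simp: color_sign_def)
    ultimately have "tally ?c {..<n} \<le> 0" by linarith
    moreover have "?c b" by simp
    ultimately have "\<not> correct_output n ?c r"
      unfolding Some correct_output_Some_iff by simp
    moreover have "consistent L s ?c" by (auto simp: consistent_def)
    ultimately show ?thesis by blast
  qed
qed

text \<open>The sign hypothesis says that the two weights do not enter the merged component with the
  same sign, so their sum stays within one. Two heavy components cancel; a heavy and a light one
  leave one heavy component.\<close>

lemma join_heavy:
  fixes d :: bool
  assumes "L x \<noteq> L y" and bal: "balanced n L s"
    and "color_sign d * (color_sign (s x) * weight n L s (L x)) * (color_sign (s y) * weight n L s (L y)) \<le> 0"
  defines "L' \<equiv> join_label L x y" and "s' \<equiv> join_color L s x y d"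
  shows "balanced n L' s'"
    and "card (heavy n L s) \<le> card (heavy n L' s') + 2"
    and "weight n L s (L x) = 0 \<or> weight n L s (L y) = 0 \<Longrightarrow> card (heavy n L s) \<le> card (heavy n L' s')"
    and "weight n L s (L x) \<noteq> 0 \<Longrightarrow> weight n L s (L y) \<noteq> 0 \<Longrightarrow> heavy n L' s' = heavy n L s - {L x, L y}"
proof -
  have w: "weight n L' s' l = (if l = L y then 0 else if l = L x
     then weight n L s (L x) + color_sign ((s x = s y) = d) * weight n L s (L y) else weight n L s l)" for l
    unfolding L'_def s'_def using assms(1) by (rule weight_join)
  have abs1: "\<bar>weight n L s l\<bar> \<le> 1" for l using bal by (simp add: balanced_def)
  have vals: "weight n L s l \<in> {-1, 0, 1}" for l using abs1[of l] by auto
  let ?q = "color_sign ((s x = s y) = d) * weight n L s (L y)"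
  have q: "?q \<in> {-1, 0, 1}" using vals[of "L y"] by (auto simp: color_sign_def)
  have "color_sign ((s x = s y) = d) = color_sign d * color_sign (s x) * color_sign (s y)"
    by (simp add: color_sign_def)
  then have opp: "weight n L s (L x) * ?q \<le> 0" using assms(3) by (simp add: mult_ac)
  have bx: "\<bar>weight n L s (L x) + ?q\<bar> \<le> 1" using vals[of "L x"] q opp by auto
  show "balanced n L' s'" unfolding balanced_def using w bx abs1 by simp
  have "heavy n L s \<subseteq> heavy n L' s' \<union> {L x, L y}" using w by (auto simp: heavy_def)
  then have "card (heavy n L s) \<le> card (heavy n L' s' \<union> {L x, L y})" by (intro card_mono) auto
  also have "\<dots> \<le> card (heavy n L' s') + card {L x, L y}" by (rule card_Un_le)
  also have "\<dots> \<le> card (heavy n L' s') + 2" using card_insert_le_m1[of 2 "{L y}" "L x"] by simp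
  finally show "card (heavy n L s) \<le> card (heavy n L' s') + 2" .
  show "card (heavy n L s) \<le> card (heavy n L' s')"
    if zero: "weight n L s (L x) = 0 \<or> weight n L s (L y) = 0"
  proof (cases "weight n L s (L y) = 0")
    case True
    then have "heavy n L s \<subseteq> heavy n L' s'" using w by (auto simp: heavy_def)
    then show ?thesis by (intro card_mono) auto
  next
    case False
    then have x0: "weight n L s (L x) = 0" using zero by blast
    \<comment> \<open>The weight moves from the label \<open>L y\<close> to the label
      \<open>L x\<close>: the set changes but its size does not drop.\<close>
    have "heavy n L s \<subseteq> insert (L y) (heavy n L' s' - {L x})" using w x0 by (auto simp: heavy_def)
    moreover have "L x \<in> heavy n L' s'" using w x0 False assms(1) by (auto simp: heavy_def color_sign_def)
    ultimately have "card (heavy n L s) \<le> card (insert (L y) (heavy n L' s' - {L x}))"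
      by (intro card_mono) auto
    also have "\<dots> \<le> Suc (card (heavy n L' s' - {L x}))" by (rule card_insert_le_m1) auto
    also have "\<dots> = card (heavy n L' s')" using \<open>L x \<in> _\<close> by (intro card_Suc_Diff1) auto
    finally show ?thesis .
  qed
  show "heavy n L' s' = heavy n L s - {L x, L y}"
    if "weight n L s (L x) \<noteq> 0" "weight n L s (L y) \<noteq> 0"
  proof -
    have "?q \<noteq> 0" using that(2) by (simp add: color_sign_def)
    then have "weight n L s (L x) + ?q = 0" using vals[of "L x"] q opp that(1) by auto
    then show ?thesis using w by (auto simp: heavy_def)
  qed
qed

lemma card3_cases:
  assumes "card Q = 3"
  obtains x y z where "Q = {x, y, z}" "x \<noteq> y" "x \<noteq> z" "y \<noteq> z"
  using assms by (auto simp: card_3_iff)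

lemma possible_answer_No: "x \<in> Q \<Longrightarrow> y \<in> Q \<Longrightarrow> c x \<noteq> c y \<Longrightarrow> possible_answer c Q (No {x, y})"
  by (auto simp: possible_answer_def)

section \<open>The general adversary\<close>

text \<open>
  Call a ball's \<open>\<tau>\<close> positive (negative) if it has the majority (minority) colour of its component.
  Two balls with \<open>\<tau>\<close> of the same sign may be declared different, which cancels their components;
  among three balls there are always two such.
\<close>

lemma adversary_step:
  assumes bal: "balanced n L s" and Q: "card Q = 3"
  shows "\<exists>a L' s'. balanced n L' s' \<and> card (heavy n L s) \<le> card (heavy n L' s') + 2 \<and>
    (\<forall>c. consistent L' s' c \<longrightarrow> consistent L s c \<and> possible_answer c Q a)"
proof -
  define \<tau> where "\<tau> i = color_sign (s i) * weight n L s (L i)" for i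
  consider (known) x y where "x \<in> Q" "y \<in> Q" "L x = L y" "s x \<noteq> s y"
    | (cancel) x y where "x \<in> Q" "y \<in> Q" "L x \<noteq> L y" "\<tau> x * \<tau> y \<ge> 0"
    | (rest) "\<And>x y. x \<in> Q \<Longrightarrow> y \<in> Q \<Longrightarrow> L x = L y \<Longrightarrow> s x = s y"
        "\<And>x y. x \<in> Q \<Longrightarrow> y \<in> Q \<Longrightarrow> L x \<noteq> L y \<Longrightarrow> \<not> 0 \<le> \<tau> x * \<tau> y"
    by blast
  then show ?thesis
  proof cases
    case known
    then have "consistent L s c \<Longrightarrow> possible_answer c Q (No {x, y})" for c
      by (intro possible_answer_No) (auto simp: consistent_def)
    then show ?thesis using bal by (meson le_add1)
  next
    case cancel
    have "color_sign False * (color_sign (s x) * weight n L s (L x)) * (color_sign (s y) * weight n L s (L y)) \<le> 0"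
      using cancel(4) by (simp add: \<tau>_def)
    note J = join_heavy[OF cancel(3) bal this]
    have "consistent L s c \<and> possible_answer c Q (No {x, y})"
      if "consistent (join_label L x y) (join_color L s x y False) c" for c
      using consistent_join[OF that cancel(3)] cancel by (auto intro: possible_answer_No)
    then show ?thesis using J(1,2) by blast
  next
    case rest
    have neg: "\<tau> x * \<tau> y < 0" if "x \<in> Q" "y \<in> Q" "L x \<noteq> L y" for x y
      using rest(2)[OF that] by simp
    have "\<exists>u v w. Q = {u, v, w} \<and> u \<noteq> v \<and> L u = L v"
    proof -
      obtain x y z where xyz: "Q = {x, y, z}" "x \<noteq> y" "x \<noteq> z" "y \<noteq> z"
        using Q by (rule card3_cases)
      \<comment> \<open>Three integers cannot have pairwise opposite signs, so two balls of the
        query share a component.\<close>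
      have "\<not> (\<tau> x * \<tau> y < 0 \<and> \<tau> x * \<tau> z < 0 \<and> \<tau> y * \<tau> z < 0)"
        by (auto simp: mult_less_0_iff)
      then have "L x = L y \<or> L x = L z \<or> L y = L z"
        using neg xyz(1) by blast
      moreover have "Q = {x, z, y}" "Q = {y, z, x}" using xyz by auto
      ultimately show ?thesis using xyz by blast
    qed
    then obtain u v w where uvw: "Q = {u, v, w}" "L u = L v" by blast
    have suv: "s u = s v" using rest(1) uvw by simp
    show ?thesis
    proof (cases "L u = L w")
      case True
      then have "consistent L s c \<Longrightarrow> possible_answer c Q Yes" for c
        using uvw suv rest(1)[of u w] by (auto simp: consistent_def possible_answer_def)
      then show ?thesis using bal by (meson le_add1)
    next
      case False
      \<comment> \<open>The third ball has the opposite sign, so declaring all three equal cancels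
        the weights: the answer is YES.\<close>
      have "\<tau> u * \<tau> w < 0" using neg uvw False by simp
      then have "color_sign True * (color_sign (s u) * weight n L s (L u)) * (color_sign (s w) * weight n L s (L w)) \<le> 0"
        by (simp add: \<tau>_def)
      note J = join_heavy[OF False bal this]
      have "consistent L s c \<and> possible_answer c Q Yes"
        if "consistent (join_label L u w) (join_color L s u w True) c" for c
      proof -
        note C = consistent_join[OF that False]
        have "c u = c v" using C(1) uvw(2) suv by (simp add: consistent_def)
        then show ?thesis using C uvw(1) by (auto simp: possible_answer_def)
      qed
      then show ?thesis using J(1,2) by blast
    qed
  qed
qed

text \<open>The hidden colouring is fixed only at the leaf: with two heavy components left it is
  chosen to make the output wrong, and each query on the way removes at most two.\<close>

lemma adversary_general:
  assumes "triple_queries n t" "balanced n L s"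
  shows "\<exists>c m r. consistent L s c \<and> play c t m r \<and>
    (correct_output n c r \<longrightarrow> card (heavy n L s) \<le> 2 * m + 1)"
  using assms
proof (induction t arbitrary: L s)
  case (Output r)
  show ?case
  proof (cases "card (heavy n L s) \<ge> 2")
    case True
    then show ?thesis
      using consistent_incorrect_output[OF Output.prems(2)] play_Output by blast
  next
    case False
    moreover have "consistent L s s" by (simp add: consistent_def)
    ultimately show ?thesis
      by (intro exI[of _ s] exI[of _ 0] exI[of _ r]) (auto intro: play_Output)
  qed
next
  case (Ask Q f)
  then have "card Q = 3" by simp
  from adversary_step[OF Ask.prems(2) this] obtain a L' s' where a:
    "balanced n L' s'" "card (heavy n L s) \<le> card (heavy n L' s') + 2"
    "\<And>c. consistent L' s' c \<Longrightarrow> consistent L s c \<and> possible_answer c Q a" by blast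
  have "\<exists>c m r. consistent L' s' c \<and> play c (f a) m r \<and>
    (correct_output n c r \<longrightarrow> card (heavy n L' s') \<le> 2 * m + 1)"
    using Ask.prems a(1) by (intro Ask.IH) auto
  then obtain c m r where c: "consistent L' s' c" "play c (f a) m r"
    "correct_output n c r \<longrightarrow> card (heavy n L' s') \<le> 2 * m + 1" by blast
  have "play c (Ask Q f) (Suc m) r" using a(3)[OF c(1)] c(2) by (blast intro: play_Ask)
  moreover have "correct_output n c r \<longrightarrow> card (heavy n L s) \<le> 2 * Suc m + 1"
    using c(3) a(2) by auto
  ultimately show ?case using a(3)[OF c(1)] by blast
qed

section \<open>The extra query for even \<open>n\<close>\<close>

text \<open>
  As long as the answers have only formed disjoint pairs of different balls, a query that does
  not consist of three unpaired balls can be answered without cancelling heavy components. For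
  even \<open>n\<close> such a query must occur, and this is the extra query.
\<close>

definition paired :: "nat \<Rightarrow> (nat \<Rightarrow> nat) \<Rightarrow> (nat \<Rightarrow> bool) \<Rightarrow> bool" where
  "paired n L s \<longleftrightarrow>
    (\<forall>i<n. \<forall>j<n. i \<noteq> j \<longrightarrow> L i = L j \<longrightarrow> s i \<noteq> s j \<and> weight n L s (L i) = 0)"

lemma paired_step:
  assumes bal: "balanced n L s" and p: "paired n L s" and Q: "card Q = 3" "Q \<subseteq> {..<n}"
  shows "\<exists>a L' s'. balanced n L' s' \<and>
    (card (heavy n L s) \<le> card (heavy n L' s') \<or>
     paired n L' s' \<and> card (heavy n L s) = card (heavy n L' s') + 2 \<and> card (heavy n L s) \<ge> 3) \<and>
    (\<forall>c. consistent L' s' c \<longrightarrow> consistent L s c \<and> possible_answer c Q a)"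
proof -
  define \<tau> where "\<tau> i = color_sign (s i) * weight n L s (L i)" for i
  have \<tau>0: "\<tau> i = 0 \<longleftrightarrow> weight n L s (L i) = 0" for i by (simp add: \<tau>_def color_sign_def)
  obtain x y z where xyz: "Q = {x, y, z}" "x \<noteq> y" "x \<noteq> z" "y \<noteq> z"
    using Q(1) by (rule card3_cases)
  consider (known) u v where "u \<in> Q" "v \<in> Q" "u \<noteq> v" "L u = L v"
    | (light) u v where "u \<in> Q" "v \<in> Q" "L u \<noteq> L v" "\<tau> u = 0"
    | (free) "L x \<noteq> L y" "L x \<noteq> L z" "L y \<noteq> L z" "\<tau> x \<noteq> 0" "\<tau> y \<noteq> 0" "\<tau> z \<noteq> 0"
    using xyz by blast
  then show ?thesis
  proof cases
    case known
    then have "s u \<noteq> s v" using p Q(2) unfolding paired_def by blast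
    then have "consistent L s c \<Longrightarrow> possible_answer c Q (No {u, v})" for c
      using known by (intro possible_answer_No) (auto simp: consistent_def)
    then show ?thesis using bal by blast
  next
    case light
    have "color_sign False * (color_sign (s u) * weight n L s (L u)) * (color_sign (s v) * weight n L s (L v)) \<le> 0"
      using light(4) by (simp add: \<tau>0)
    note J = join_heavy[OF light(3) bal this]
    have "consistent L s c \<and> possible_answer c Q (No {u, v})"
      if "consistent (join_label L u v) (join_color L s u v False) c" for c
      using consistent_join[OF that light(3)] light by (auto intro: possible_answer_No)
    moreover have "weight n L s (L u) = 0" using light(4) \<tau>0 by simp
    ultimately show ?thesis using J(1,3) by blast
  next
    case free
    have "\<tau> x * \<tau> y \<ge> 0 \<or> \<tau> x * \<tau> z \<ge> 0 \<or> \<tau> y * \<tau> z \<ge> 0"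
      by (simp add: zero_le_mult_iff) linarith
    then obtain u v where uv: "u \<in> Q" "v \<in> Q" "u \<noteq> v" "L u \<noteq> L v" "\<tau> u * \<tau> v \<ge> 0"
      using free xyz by blast
    have wuv: "weight n L s (L u) \<noteq> 0" "weight n L s (L v) \<noteq> 0"
      using uv(1,2) free xyz(1) \<tau>0 by auto
    have uvn: "u < n" "v < n" using uv Q(2) by auto
    have "color_sign False * (color_sign (s u) * weight n L s (L u)) * (color_sign (s v) * weight n L s (L v)) \<le> 0"
      using uv(5) by (simp add: \<tau>_def)
    note J = join_heavy[OF uv(4) bal this]
    let ?L = "join_label L u v" and ?s = "join_color L s u v False"
    have H: "heavy n ?L ?s = heavy n L s - {L u, L v}" using J(4) wuv by blast
    have "{L u, L v} \<subseteq> heavy n L s" using wuv by (simp add: heavy_def)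
    then have c2: "card (heavy n L s) = card (heavy n ?L ?s) + 2"
      unfolding H using uv(4) card_mono[OF finite_heavy, of "{L u, L v}" n L s]
      by (subst card_Diff_subset) auto
    have "{L x, L y, L z} \<subseteq> heavy n L s" using free \<tau>0 by (simp add: heavy_def)
    then have c3: "card (heavy n L s) \<ge> 3"
      using free card_mono[OF finite_heavy, of "{L x, L y, L z}" n L s] by simp
    \<comment> \<open>A paired component weighs 0, so a heavy component contains a single
      ball.\<close>
    have single: "i = k" if "i < n" "k < n" "L i = L k" "weight n L s (L k) \<noteq> 0" for i k
      using p that unfolding paired_def by metis
    have "paired n ?L ?s"
      unfolding paired_def
    proof (intro allI impI)
      fix i j assume ij: "i < n" "j < n" "i \<noteq> j" "?L i = ?L j"
      show "?s i \<noteq> ?s j \<and> weight n ?L ?s (?L i) = 0"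
      proof (cases "L i = L j")
        case True
        then have o: "s i \<noteq> s j" "weight n L s (L i) = 0"
          using p ij unfolding paired_def by blast+
        then have "L i \<noteq> L u" "L i \<noteq> L v" using wuv by metis+
        then show ?thesis using o True
          by (auto simp: weight_join[of L u v, OF uv(4)] join_label_def join_color_def)
      next
        case False
        then have "L i = L u \<and> L j = L v \<or> L i = L v \<and> L j = L u"
          using ij(4) by (auto simp: join_label_def split: if_splits)
        then have "i = u \<and> j = v \<or> i = v \<and> j = u"
          using single ij(1,2) uvn wuv by blast
        moreover have "weight n ?L ?s (L u) = 0" using H by (auto simp: heavy_def)
        ultimately show ?thesis
          using uv(4) by (auto simp: join_label_def join_color_def)
      qed
    qed
    moreover have "consistent L s c \<and> possible_answer c Q (No {u, v})"
      if "consistent ?L ?s c" for c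
      using consistent_join[OF that uv(4)] uv by (auto intro: possible_answer_No)
    ultimately show ?thesis using J(1) c2 c3 by blast
  qed
qed

text \<open>A query of three unpaired balls requires three heavy components, and with two left every
  output can be refuted, so a query that cancels nothing must come. From then on
  \<open>paired\<close> may fail and \<open>adversary_general\<close> takes over; the free query
  supplies the extra one in the bound.\<close>

lemma adversary_paired:
  assumes "triple_queries n t" "balanced n L s" "paired n L s"
    "even (card (heavy n L s))" "card (heavy n L s) \<ge> 2"
  shows "\<exists>c m r. play c t m r \<and> consistent L s c \<and>
    (correct_output n c r \<longrightarrow> card (heavy n L s) + 1 \<le> 2 * m)"
  using assms
proof (induction t arbitrary: L s)
  case (Output r)
  then show ?case using consistent_incorrect_output play_Output by blast
next
  case (Ask Q f)
  have Q: "card Q = 3" "Q \<subseteq> {..<n}" using Ask.prems(1) by auto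
  from paired_step[OF Ask.prems(2,3) Q] obtain a L' s' where a:
    "balanced n L' s'" "card (heavy n L s) \<le> card (heavy n L' s') \<or>
     paired n L' s' \<and> card (heavy n L s) = card (heavy n L' s') + 2 \<and> card (heavy n L s) \<ge> 3"
    "\<And>c. consistent L' s' c \<Longrightarrow> consistent L s c \<and> possible_answer c Q a" by blast
  have tf: "triple_queries n (f a)" using Ask.prems(1) by simp
  have "\<exists>c m r. play c (f a) m r \<and> consistent L' s' c \<and>
    (correct_output n c r \<longrightarrow> card (heavy n L s) + 1 \<le> 2 * Suc m)"
    using a(2)
  proof
    assume "card (heavy n L s) \<le> card (heavy n L' s')"
    then show ?thesis using adversary_general[OF tf a(1)] by fastforce
  next
    assume b: "paired n L' s' \<and> card (heavy n L s) = card (heavy n L' s') + 2 \<and> card (heavy n L s) \<ge> 3"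
    \<comment> \<open>At least three heavy components before, and an even number of them, leave at
      least two.\<close>
    then have e: "even (card (heavy n L' s'))" "card (heavy n L' s') \<noteq> 0" using Ask.prems(4) by auto
    then have "card (heavy n L' s') \<ge> 2" by (metis One_nat_def even_Suc even_zero less_2_cases not_less)
    then have "\<exists>c m r. play c (f a) m r \<and> consistent L' s' c \<and>
      (correct_output n c r \<longrightarrow> card (heavy n L' s') + 1 \<le> 2 * m)"
      using b e tf a(1) by (intro Ask.IH) auto
    then show ?thesis using b by fastforce
  qed
  then obtain c m r where c: "play c (f a) m r" "consistent L' s' c"
    "correct_output n c r \<longrightarrow> card (heavy n L s) + 1 \<le> 2 * Suc m" by blast
  then have "play c (Ask Q f) (Suc m) r" using a(3)[OF c(2)] by (blast intro: play_Ask)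
  then show ?case using a(3)[OF c(2)] c(3) by blast
qed

section \<open>The lower bound\<close>

lemma solves_majority_lower_bound:
  assumes "solves_majority_within n k t" and n: "n \<ge> 2"
  shows "(if even n then n div 2 + 1 else n div 2) \<le> k"
proof -
  \<comment> \<open>The adversary starts with singleton components, so that every ball is
    heavy.\<close>
  let ?s = "\<lambda>_::nat. True"
  have t: "triple_queries n t" and
    sol: "\<And>c m r. play c t m r \<Longrightarrow> m \<le> k \<and> correct_output n c r"
    using assms by (auto simp: solves_majority_within_def)
  have "{i. i < n \<and> id i = l} = (if l < n then {l} else {})" for l :: nat by auto
  then have w: "weight n id ?s l = (if l < n then 1 else 0)" for l by (simp add: weight_def)
  then have H: "heavy n id ?s = {..<n}" by (auto simp: heavy_def)
  have bal: "balanced n id ?s" by (simp add: balanced_def w)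
  show ?thesis
  proof (cases "even n")
    case True
    have "paired n id ?s" by (simp add: paired_def)
    then obtain c m r where "play c t m r" "correct_output n c r \<longrightarrow> n + 1 \<le> 2 * m"
      using adversary_paired[OF t bal] H n True by auto
    then have "n + 1 \<le> 2 * k" using sol by fastforce
    \<comment> \<open>For even \<open>n\<close>, \<open>n + 1 \<le> 2 * k\<close> already forces
      \<open>n + 2 \<le> 2 * k\<close>.\<close>
    then show ?thesis using True by auto
  next
    case False
    obtain c m r where "play c t m r" "correct_output n c r \<longrightarrow> n \<le> 2 * m + 1"
      using adversary_general[OF t bal] H by auto
    then have "n \<le> 2 * k + 1" using sol by fastforce
    then show ?thesis using False by auto
  qed
qed

section \<open>The questioner\<close>

text \<open>The set \<open>S\<close> holds the colourings still possible after some answers, so that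
  strategies can be built from the leaves upwards.\<close>

definition solvable :: "nat \<Rightarrow> nat \<Rightarrow> (nat \<Rightarrow> bool) set \<Rightarrow> bool" where
  "solvable n k S \<longleftrightarrow> (\<exists>t. triple_queries n t \<and>
     (\<forall>c\<in>S. \<forall>m r. play c t m r \<longrightarrow> m \<le> k \<and> correct_output n c r))"

lemma solvable_UNIV_iff: "solvable n k UNIV \<longleftrightarrow> (\<exists>t. solves_majority_within n k t)"
  by (simp add: solvable_def solves_majority_within_def)

lemma solvable_mono:
  assumes "solvable n k S" "S' \<subseteq> S" "k \<le> k'"
  shows "solvable n k' S'"
proof -
  obtain t where t: "triple_queries n t"
    "\<And>c m r. c \<in> S \<Longrightarrow> play c t m r \<Longrightarrow> m \<le> k \<and> correct_output n c r"
    using assms(1) unfolding solvable_def by blast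
  show ?thesis
    unfolding solvable_def using t assms(2,3) by (intro exI[of _ t]) fastforce
qed

lemma solvable_output:
  assumes "\<And>c. c \<in> S \<Longrightarrow> correct_output n c r"
  shows "solvable n k S"
  unfolding solvable_def
proof (intro exI[of _ "Output r"] conjI ballI allI impI)
  fix c m r' assume c: "c \<in> S" and "play c (Output r) m r'"
  from this(2) show "m \<le> k" by cases simp
  from \<open>play c (Output r) m r'\<close> show "correct_output n c r'" using assms[OF c] by cases simp
qed simp

lemma solvable_ask_answers:
  assumes Q: "Q \<subseteq> {..<n}" "card Q = 3"
    and "\<And>a. solvable n k {c \<in> S. possible_answer c Q a}"
  shows "solvable n (Suc k) S"
proof -
  have "\<forall>a. \<exists>t. triple_queries n t \<and> (\<forall>c\<in>{c \<in> S. possible_answer c Q a}. \<forall>m r.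
      play c t m r \<longrightarrow> m \<le> k \<and> correct_output n c r)"
    using assms(3) unfolding solvable_def by (rule allI)
  from choice[OF this] obtain f where f: "\<And>a. triple_queries n (f a)"
    "\<And>a c m r. c \<in> S \<Longrightarrow> possible_answer c Q a \<Longrightarrow> play c (f a) m r \<Longrightarrow> m \<le> k \<and> correct_output n c r"
    by fast
  show ?thesis
    unfolding solvable_def
  proof (intro exI[of _ "Ask Q f"] conjI ballI allI impI)
    show "triple_queries n (Ask Q f)" using Q f(1) by simp
    fix c m r assume c: "c \<in> S" and p: "play c (Ask Q f) m r"
    from p show "m \<le> Suc k" using f(2)[OF c] by cases auto
    from p show "correct_output n c r" using f(2)[OF c] by cases auto
  qed
qed

text \<open>A single answer confines all colourings allowing it to one of the four sets: YES to the
  first, NO to that of its pair. If the set shown is not a pair from the query, no colouring allows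
  it and any of the four will do.\<close>

lemma solvable_ask:
  assumes xyz: "x < n" "y < n" "z < n" "x \<noteq> y" "x \<noteq> z" "y \<noteq> z"
    and yes: "solvable n k {c \<in> S. c x = c y \<and> c y = c z}"
    and xy: "solvable n k {c \<in> S. c x \<noteq> c y}"
    and xz: "solvable n k {c \<in> S. c x \<noteq> c z}"
    and yz: "solvable n k {c \<in> S. c y \<noteq> c z}"
  shows "solvable n (Suc k) S"
proof (rule solvable_ask_answers[of "{x, y, z}"])
  fix a
  let ?P = "\<lambda>c. possible_answer c {x, y, z} a"
  have "(\<forall>c. ?P c \<longrightarrow> c x = c y \<and> c y = c z) \<or> (\<forall>c. ?P c \<longrightarrow> c x \<noteq> c y) \<or>
      (\<forall>c. ?P c \<longrightarrow> c x \<noteq> c z) \<or> (\<forall>c. ?P c \<longrightarrow> c y \<noteq> c z)"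
  proof (cases a)
    case Yes
    show ?thesis unfolding possible_answer_def Yes by (intro disjI1) blast
  next
    case (No P)
    have pair: "c u \<noteq> c v" if *: "?P c" "P = {u, v}" for c u v
    proof -
      obtain u' v' where "c u' \<noteq> c v'" "{u', v'} = {u, v}"
        using * unfolding possible_answer_def No by blast
      then show ?thesis unfolding doubleton_eq_iff by fastforce
    qed
    have ex: "P = {x, y} \<or> P = {x, z} \<or> P = {y, z}" if "?P c" for c
    proof -
      obtain u v where "u \<in> {x, y, z}" "v \<in> {x, y, z}" "u \<noteq> v" "P = {u, v}"
        using \<open>?P c\<close> unfolding possible_answer_def No by blast
      then show ?thesis by (elim insertE emptyE) (simp_all add: insert_commute)
    qed
    consider "P = {x, y}" | "P = {x, z}" | "P = {y, z}" | "\<not> (P = {x, y} \<or> P = {x, z} \<or> P = {y, z})"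
      by argo
    then show ?thesis
    proof cases
      case 1
      then show ?thesis using pair by presburger
    next
      case 2
      then show ?thesis using pair by presburger
    next
      case 3
      then show ?thesis using pair by presburger
    next
      case 4
      then show ?thesis using ex by presburger
    qed
  qed
  then show "solvable n k {c \<in> S. ?P c}"
  proof (elim disjE)
    assume "\<forall>c. ?P c \<longrightarrow> c x = c y \<and> c y = c z"
    then show ?thesis by (intro solvable_mono[OF yes]) auto
  next
    assume "\<forall>c. ?P c \<longrightarrow> c x \<noteq> c y"
    then show ?thesis by (intro solvable_mono[OF xy]) auto
  next
    assume "\<forall>c. ?P c \<longrightarrow> c x \<noteq> c z"
    then show ?thesis by (intro solvable_mono[OF xz]) auto
  next
    assume "\<forall>c. ?P c \<longrightarrow> c y \<noteq> c z"
    then show ?thesis by (intro solvable_mono[OF yz]) auto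
  qed
qed (use xyz in auto)

text \<open>Since \<open>u\<close> and \<open>v\<close> are known to agree, a NO must show
  \<open>x\<close> against one of them, so the triple query acts as a comparison of two
  balls.\<close>

lemma solvable_compare:
  assumes "u < n" "v < n" "x < n" "u \<noteq> v" "u \<noteq> x" "v \<noteq> x"
    and uv: "\<And>c. c \<in> S \<Longrightarrow> c u = c v"
    and eq: "solvable n k {c \<in> S. c x = c u}" and ne: "solvable n k {c \<in> S. c x \<noteq> c u}"
  shows "solvable n (Suc k) S"
proof (rule solvable_ask[of u n v x])
  show "solvable n k {c \<in> S. c u = c v \<and> c v = c x}" by (rule solvable_mono[OF eq]) auto
  \<comment> \<open>This set of colourings is empty.\<close>
  show "solvable n k {c \<in> S. c u \<noteq> c v}" by (rule solvable_mono[OF eq]) (auto simp: uv)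
  show "solvable n k {c \<in> S. c u \<noteq> c x}" by (rule solvable_mono[OF ne]) auto
  show "solvable n k {c \<in> S. c v \<noteq> c x}" by (rule solvable_mono[OF ne]) (auto simp: uv)
qed (use assms in auto)

section \<open>Units, groups and the remainder\<close>

text \<open>
  The balls in \<open>X\<close> and \<open>Y\<close> represent groups of net weight \<open>w\<close> and \<open>3 * w\<close>; all other balls together
  contribute \<open>J\<close>.
\<close>

definition reduced ::
  "nat \<Rightarrow> (nat \<Rightarrow> bool) set \<Rightarrow> int \<Rightarrow> nat set \<Rightarrow> nat set \<Rightarrow> ((nat \<Rightarrow> bool) \<Rightarrow> int) \<Rightarrow> bool" where
  "reduced n S w X Y J \<longleftrightarrow> X \<union> Y \<subseteq> {..<n} \<and> X \<inter> Y = {} \<and> 0 < w \<and>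
     (\<forall>c\<in>S. \<bar>J c\<bar> < w \<and> tally c {..<n} = w * tally c X + 3 * w * tally c Y + J c)"

text \<open>A mate is a second ball of known equal colour. Lying outside \<open>Z\<close>, the
  current units, it is distinct from every ball it helps to compare, as
  \<open>solvable_compare\<close> demands.\<close>

definition mated :: "nat \<Rightarrow> (nat \<Rightarrow> bool) set \<Rightarrow> nat set \<Rightarrow> nat set \<Rightarrow> bool" where
  "mated n S Z V \<longleftrightarrow> (\<forall>v\<in>V. \<exists>u<n. u \<notin> Z \<and> (\<forall>c\<in>S. c u = c v))"

text \<open>Here \<open>r\<close> is the output that is right if the units tie and only
  \<open>J\<close> counts.\<close>

definition decides :: "nat \<Rightarrow> (nat \<Rightarrow> bool) set \<Rightarrow> ((nat \<Rightarrow> bool) \<Rightarrow> int) \<Rightarrow> nat option \<Rightarrow> bool" where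
  "decides n S J r \<longleftrightarrow>
     (\<forall>c\<in>S. case r of None \<Rightarrow> J c = 0 | Some b \<Rightarrow> b < n \<and> color_sign (c b) * J c > 0)"

lemma reduced_finite:
  assumes "reduced n S w X Y J"
  shows "finite X" "finite Y"
  using assms by (auto simp: reduced_def intro: finite_subset[OF _ finite_lessThan[of n]])

lemma mated_mono: "mated n S Z V \<Longrightarrow> S' \<subseteq> S \<Longrightarrow> Z' \<subseteq> Z \<Longrightarrow> V' \<subseteq> V \<Longrightarrow> mated n S' Z' V'"
  unfolding mated_def by (meson subsetD)

lemma mated_obtain:
  assumes "mated n S Z V" "v \<in> V"
  obtains u where "u < n" "u \<notin> Z" "\<forall>c\<in>S. c u = c v"
proof -
  from bspec[OF assms(1)[unfolded mated_def] assms(2)] show ?thesis by (elim exE conjE) (rule that)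
qed

lemma decides_mono: "decides n S J r \<Longrightarrow> S' \<subseteq> S \<Longrightarrow> decides n S' J r"
  unfolding decides_def by blast

lemma tally_remove: "finite A \<Longrightarrow> a \<in> A \<Longrightarrow> tally c A = color_sign (c a) + tally c (A - {a})"
  unfolding tally_def by (rule sum.remove)

lemma reduced_mono: "reduced n S w X Y J \<Longrightarrow> S' \<subseteq> S \<Longrightarrow> reduced n S' w X Y J"
  unfolding reduced_def by blast

lemma reduced_cancel:
  assumes r: "reduced n S w X Y J" and x: "x \<in> X" "y \<in> X" "x \<noteq> y"
  shows "reduced n {c \<in> S. c x \<noteq> c y} w (X - {x, y}) Y J"
proof -
  have fin: "finite X" using r by (rule reduced_finite)
  have "tally c (X - {x, y}) = tally c X" if "c x \<noteq> c y" for c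
  proof -
    have "tally c X = color_sign (c x) + (color_sign (c y) + tally c (X - {x} - {y}))"
      using fin x by (simp add: tally_remove[of X x] tally_remove[of "X - {x}" y])
    moreover have "X - {x} - {y} = X - {x, y}" by blast
    ultimately show ?thesis using that by (cases "c x"; cases "c y"; simp)
  qed
  then show ?thesis using r by (auto simp: reduced_def)
qed

lemma reduced_merge:
  assumes r: "reduced n S w X Y J" and x: "x \<in> X" "y \<in> X" "z \<in> X" "x \<noteq> y" "x \<noteq> z" "y \<noteq> z"
  shows "reduced n {c \<in> S. c x = c y \<and> c y = c z} w (X - {x, y, z}) (insert x Y) J"
proof -
  have fin: "finite X" "finite Y" using r by (rule reduced_finite)+
  have xY: "x \<notin> Y" using r x(1) by (auto simp: reduced_def)
  have "tally c X = 3 * color_sign (c x) + tally c (X - {x, y, z})" if "c x = c y" "c y = c z" for c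
  proof -
    have "tally c X = color_sign (c x) + (color_sign (c y) + (color_sign (c z) + tally c (X - {x} - {y} - {z})))"
      using fin x by (simp add: tally_remove[of X x] tally_remove[of "X - {x}" y] tally_remove[of "X - {x} - {y}" z])
    moreover have "X - {x} - {y} - {z} = X - {x, y, z}" by blast
    ultimately show ?thesis using that by simp
  qed
  then show ?thesis using r x(1) xY fin by (auto simp: reduced_def algebra_simps)
qed

text \<open>The ball \<open>y\<close> leaves the units with the colour of \<open>x\<close> and
  becomes its mate; old mates were outside all units and remain so.\<close>

lemma mated_merge:
  assumes m: "mated n S (X \<union> Y) V" and x: "x \<in> X" "y \<in> X" "x \<noteq> y" "y < n" "y \<notin> Y"
  shows "mated n {c \<in> S. c x = c y \<and> c y = c z} (X - {x, y, z} \<union> insert x Y) (insert x V)"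
  unfolding mated_def
proof
  fix v assume "v \<in> insert x V"
  then consider "v = x" | "v \<in> V" by blast
  then show "\<exists>u<n. u \<notin> X - {x, y, z} \<union> insert x Y \<and> (\<forall>c\<in>{c \<in> S. c x = c y \<and> c y = c z}. c u = c v)"
  proof cases
    case 1
    then show ?thesis using x by (intro exI[of _ y]) auto
  next
    case 2
    then obtain u where "u < n" "u \<notin> X \<union> Y" "\<forall>c\<in>S. c u = c v" using m unfolding mated_def by blast
    then show ?thesis using x by (intro exI[of _ u]) auto
  qed
qed

text \<open>The leftover units contribute at most \<open>2 * w\<close> and \<open>J\<close> less
  than \<open>w\<close>, so together they stay below the weight of one group and form the new
  remainder.\<close>

lemma reduced_rescale:
  assumes r: "reduced n S w X Y J" and X: "card X \<le> 2"
  shows "reduced n S (3 * w) Y {} (\<lambda>c. J c + w * tally c X)"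
proof -
  have w: "w > 0" using r by (simp add: reduced_def)
  have "\<bar>J c + w * tally c X\<bar> < 3 * w" if "c \<in> S" for c
  proof -
    have "\<bar>tally c X\<bar> \<le> 2" using abs_tally_le_card[of c X] X by linarith
    then have "\<bar>w * tally c X\<bar> \<le> w * 2" using w by (simp add: abs_mult)
    moreover have "\<bar>J c\<bar> < w" using r that by (simp add: reduced_def)
    ultimately show ?thesis by linarith
  qed
  then show ?thesis using r w by (auto simp: reduced_def)
qed

text \<open>This is the query shared by both inductions below. Sizes and the reduced state are
  handed to the two cases, so each induction adds only its own invariants.\<close>

lemma solvable_merge_step:
  assumes r: "reduced n S w X Y J" and X: "card X \<ge> 3"
    and yes: "\<And>x y z. x \<in> X \<Longrightarrow> y \<in> X \<Longrightarrow> z \<in> X \<Longrightarrow> x \<noteq> y \<Longrightarrow> x \<noteq> z \<Longrightarrow> y \<noteq> z \<Longrightarrow>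
      reduced n {c \<in> S. c x = c y \<and> c y = c z} w (X - {x, y, z}) (insert x Y) J \<Longrightarrow>
      card (X - {x, y, z}) = card X - 3 \<Longrightarrow> card (insert x Y) = Suc (card Y) \<Longrightarrow> y < n \<Longrightarrow> y \<notin> Y \<Longrightarrow>
      solvable n k {c \<in> S. c x = c y \<and> c y = c z}"
    and no: "\<And>x y. x \<in> X \<Longrightarrow> y \<in> X \<Longrightarrow> x \<noteq> y \<Longrightarrow> x < n \<Longrightarrow> y < n \<Longrightarrow>
      reduced n {c \<in> S. c x \<noteq> c y} w (X - {x, y}) Y J \<Longrightarrow> card (X - {x, y}) = card X - 2 \<Longrightarrow>
      solvable n k {c \<in> S. c x \<noteq> c y}"
  shows "solvable n (Suc k) S"
proof -
  have fin: "finite X" "finite Y" using r by (rule reduced_finite)+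
  obtain T where "T \<subseteq> X" "card T = 3" using X by (meson obtain_subset_with_card_n)
  then obtain x y z where xyz: "x \<in> X" "y \<in> X" "z \<in> X" "x \<noteq> y" "x \<noteq> z" "y \<noteq> z"
    by (auto simp: card_3_iff)
  have lt: "u < n" and nY: "u \<notin> Y" if "u \<in> X" for u using r that by (auto simp: reduced_def)
  have no': "solvable n k {c \<in> S. c u \<noteq> c v}" if "u \<in> X" "v \<in> X" "u \<noteq> v" for u v
    using that fin by (intro no reduced_cancel[OF r] lt) (auto simp: card_Diff_subset)
  have "solvable n k {c \<in> S. c x = c y \<and> c y = c z}"
    using xyz fin nY by (intro yes reduced_merge[OF r] lt) (auto simp: card_Diff_subset)
  then show ?thesis using xyz no' lt by (intro solvable_ask[of x n y z]) auto
qed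

section \<open>Recursion on the groups\<close>

text \<open>
  An odd number of groups cannot tie, and \<open>J\<close> is too small to change the outcome. With an even
  number \<open>J\<close> breaks ties, so its sign has to be known.
\<close>

lemma solvable_reduced:
  assumes "reduced n S w X Y J" "mated n S (X \<union> Y) Y"
    and "even (card X + card Y) \<Longrightarrow> mated n S (X \<union> Y) X \<and> (\<exists>r. decides n S J r)"
  shows "solvable n ((card X + card Y) div 2) S"
  using assms
\<comment> \<open>A merge lowers this measure by 1, a cancellation by 2, and rescaling replaces it
  by \<open>card Y\<close>.\<close>
proof (induction "card X + 2 * card Y" arbitrary: S w X Y J rule: less_induct)
  case less
  note red = less.prems(1) and mY = less.prems(2) and ev = less.prems(3)
  have fin: "finite X" "finite Y" using red by (rule reduced_finite)+
  show ?case
  proof (cases "card X \<ge> 3")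
    case True
    \<comment> \<open>Either answer costs one query and removes two units, which also preserves the
      parity.\<close>
    have k: "(card X + card Y) div 2 = Suc ((card X - 2 + card Y) div 2)" using True by linarith
    show ?thesis
      unfolding k
    proof (rule solvable_merge_step[OF red True])
      fix x y z
      let ?S = "{c \<in> S. c x = c y \<and> c y = c z}" and ?X = "X - {x, y, z}" and ?Y = "insert x Y"
      assume xyz: "x \<in> X" "y \<in> X" "z \<in> X" "x \<noteq> y" "x \<noteq> z" "y \<noteq> z" "y < n" "y \<notin> Y"
        and r': "reduced n ?S w ?X ?Y J"
        and ca: "card ?X = card X - 3" "card ?Y = Suc (card Y)"
      have "solvable n ((card ?X + card ?Y) div 2) ?S"
      proof (rule less.hyps[OF _ r'])
        show "card ?X + 2 * card ?Y < card X + 2 * card Y" using ca True by simp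
        show "mated n ?S (?X \<union> ?Y) ?Y" using xyz by (intro mated_merge[OF mY]) auto
        assume "even (card ?X + card ?Y)"
        then have "even (card X + card Y)" unfolding ca using True by presburger
        then obtain r where mr: "mated n S (X \<union> Y) X" "decides n S J r" using ev by blast
        have "mated n ?S (?X \<union> ?Y) (insert x X)"
          using xyz by (intro mated_merge[OF mr(1)]) auto
        then have "mated n ?S (?X \<union> ?Y) ?X" by (rule mated_mono) auto
        moreover have "decides n ?S J r" by (rule decides_mono[OF mr(2)]) auto
        ultimately show "mated n ?S (?X \<union> ?Y) ?X \<and> (\<exists>r. decides n ?S J r)" by blast
      qed
      then show "solvable n ((card X - 2 + card Y) div 2) ?S"
        by (rule solvable_mono) (use ca True in simp_all)
    next
      fix x y
      let ?S = "{c \<in> S. c x \<noteq> c y}" and ?X = "X - {x, y}"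
      assume xy: "x \<in> X" "y \<in> X" "x \<noteq> y" and r': "reduced n ?S w ?X Y J"
        and ca: "card ?X = card X - 2"
      have "solvable n ((card ?X + card Y) div 2) ?S"
      proof (rule less.hyps[OF _ r'])
        show "card ?X + 2 * card Y < card X + 2 * card Y" using ca True by simp
        show "mated n ?S (?X \<union> Y) Y" by (rule mated_mono[OF mY]) auto
        assume "even (card ?X + card Y)"
        then have "even (card X + card Y)" unfolding ca using True by presburger
        then obtain r where mr: "mated n S (X \<union> Y) X" "decides n S J r" using ev by blast
        have "mated n ?S (?X \<union> Y) ?X" by (rule mated_mono[OF mr(1)]) auto
        moreover have "decides n ?S J r" by (rule decides_mono[OF mr(2)]) auto
        ultimately show "mated n ?S (?X \<union> Y) ?X \<and> (\<exists>r. decides n ?S J r)" by blast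
      qed
      then show "solvable n ((card X - 2 + card Y) div 2) ?S" unfolding ca .
    qed
  next
    case False
    then have X2: "card X \<le> 2" by simp
    let ?J = "\<lambda>c. J c + w * tally c X"
    have rs: "reduced n S (3 * w) Y {} ?J" using red X2 by (rule reduced_rescale)
    have w: "w > 0" and lt: "\<And>x. x \<in> X \<Longrightarrow> x < n" and J: "\<And>c. c \<in> S \<Longrightarrow> \<bar>J c\<bar> < w"
      using red by (auto simp: reduced_def)
    \<comment> \<open>This is the recursive call with the groups as units; the new remainder must be
      decided only when their number is even.\<close>
    have step: "solvable n (card Y div 2) S'"
      if "S' \<subseteq> S" "card X + card Y > 0" "even (card Y) \<Longrightarrow> \<exists>r. decides n S' ?J r" for S'
    proof -
      have "solvable n ((card Y + card ({} :: nat set)) div 2) S'"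
      proof (rule less.hyps)
        show "card Y + 2 * card ({} :: nat set) < card X + 2 * card Y" using that(2) by auto
        show "reduced n S' (3 * w) Y {} ?J" using rs that(1) by (rule reduced_mono)
        show "mated n S' (Y \<union> {}) {}" by (simp add: mated_def)
        assume "even (card Y + card ({} :: nat set))"
        then show "mated n S' (Y \<union> {}) Y \<and> (\<exists>r. decides n S' ?J r)"
          using that mated_mono[OF mY that(1)] by simp
      qed
      then show ?thesis by simp
    qed
    consider "card X = 0" "card Y = 0" | "card X = 0" "card Y > 0" | "card X = 1"
      | "card X = 2" "odd (card Y)" | "card X = 2" "even (card Y)" using X2 by linarith
    then show ?thesis
    proof cases
      case 1
      then have XY: "X = {}" "Y = {}" using fin by auto
      obtain r where r: "decides n S J r" using ev 1 by auto
      show ?thesis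
      proof (rule solvable_output[of _ _ r])
        fix c assume c: "c \<in> S"
        then have "tally c {..<n} = J c" using red XY by (simp add: reduced_def)
        then show "correct_output n c r" using r c
          by (cases r) (auto simp: decides_def correct_output_None_iff correct_output_Some_iff
              simp del: correct_output.simps)
      qed
    next
      case 2
      then have "X = {}" using fin by auto
      then have "solvable n (card Y div 2) S" using ev 2 by (intro step) auto
      then show ?thesis using 2 by simp
    next
      case 3
      then obtain x where x: "X = {x}" by (rule card_1_singletonE)
      \<comment> \<open>A single leftover unit outweighs \<open>J\<close>, so its ball settles a
        tie.\<close>
      have "decides n S ?J (Some x)"
        using x lt unfolding decides_def by (auto simp: color_sign_def dest: J)
      then have "solvable n (card Y div 2) S" using 3 by (intro step) auto
      then show ?thesis by (rule solvable_mono) (auto simp: 3)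
    next
      case 4
      then have "solvable n (card Y div 2) S" by (intro step) auto
      then show ?thesis by (rule solvable_mono) auto
    next
      case 5
      then obtain x y where xy: "X = {x, y}" "x \<noteq> y" by (auto simp: card_2_iff)
      have m: "mated n S (X \<union> Y) X" and "\<exists>r. decides n S J r" using ev 5 by auto
      then obtain r where r: "decides n S J r" by blast
      have "x \<in> X" by (simp add: xy)
      with m obtain u where u: "u < n" "u \<notin> X \<union> Y" "\<forall>c\<in>S. c u = c x" by (rule mated_obtain)
      have ux: "c u = c x" if "c \<in> S" for c using u(3) that by (rule bspec)
      have ne: "x < n" "y < n" "u \<noteq> x" "u \<noteq> y" using u(2) lt xy by auto
      \<comment> \<open>The mate of \<open>x\<close> makes one query enough. Equal leftovers
        outweigh \<open>J\<close> and \<open>x\<close> decides; different ones cancel and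
        \<open>r\<close> still decides.\<close>
      have "solvable n (Suc (card Y div 2)) S"
      proof (rule solvable_compare[of u n x y])
        have "color_sign (c x) * ?J c > 0" if "c \<in> S" "c y = c u" for c
          using J[OF that(1)] ux[OF that(1)] that(2) xy by (cases "c x") auto
        then have "decides n {c \<in> S. c y = c u} ?J (Some x)" using ne by (simp add: decides_def)
        then show "solvable n (card Y div 2) {c \<in> S. c y = c u}" using 5 by (intro step) auto
        have "tally c X = 0" if "c \<in> S" "c y \<noteq> c u" for c
          using ux[OF that(1)] that(2) xy by (cases "c x") auto
        then have "decides n {c \<in> S. c y \<noteq> c u} ?J r"
          using r by (cases r) (auto simp: decides_def)
        then show "solvable n (card Y div 2) {c \<in> S. c y \<noteq> c u}" using 5 by (intro step) auto
        show "c u = c x" if "c \<in> S" for c using ux[OF that] .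
      qed (use u(1) ne xy(2) in auto)
      then show ?thesis using 5 by simp
    qed
  qed
qed

lemma solvable_odd:
  assumes "odd n"
  shows "solvable n (n div 2) UNIV"
proof -
  have "solvable n ((card {..<n} + card ({} :: nat set)) div 2) UNIV"
    using assms by (intro solvable_reduced[of _ _ 1 _ _ "\<lambda>_. 0"]) (auto simp: reduced_def mated_def)
  then show ?thesis by simp
qed

section \<open>Single balls as units for even \<open>n\<close>\<close>

text \<open>
  Units of weight 1 have no mates, so comparing the last two of them costs one query more than
  comparing two larger groups.
\<close>

lemma solvable_reduced_unit:
  assumes n: "n \<ge> 4"
    and "reduced n S 1 X Y (\<lambda>_. 0)" "mated n S (X \<union> Y) Y" "even (card X + card Y)"
    and "Y \<noteq> {} \<or> X = {..<n} \<or> (\<exists>u<n. \<exists>v<n. u \<notin> X \<and> v \<notin> X \<and> (\<forall>c\<in>S. c u \<noteq> c v))"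
  shows "solvable n ((card X + card Y) div 2 + 1) S"
  using assms(2-)
\<comment> \<open>The last hypothesis records the means for comparing two leftover balls: a group
  with its mate, or a discarded pair of different colours. Its middle case is the start, where
  neither exists yet.\<close>
proof (induction "card X" arbitrary: S X Y rule: less_induct)
  case less
  note red = less.prems(1) and mY = less.prems(2) and ev = less.prems(3)
  have fin: "finite X" "finite Y" using red by (rule reduced_finite)+
  show ?case
  proof (cases "card X \<ge> 3")
    case True
    have k: "(card X + card Y) div 2 + 1 = Suc ((card X - 2 + card Y) div 2 + 1)" using True by linarith
    show ?thesis
      unfolding k
    proof (rule solvable_merge_step[OF red True])
      fix x y z
      let ?S = "{c \<in> S. c x = c y \<and> c y = c z}" and ?X = "X - {x, y, z}" and ?Y = "insert x Y"
      assume xyz: "x \<in> X" "y \<in> X" "z \<in> X" "x \<noteq> y" "x \<noteq> z" "y \<noteq> z" "y < n" "y \<notin> Y"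
        and r': "reduced n ?S 1 ?X ?Y (\<lambda>_. 0)"
        and ca: "card ?X = card X - 3" "card ?Y = Suc (card Y)"
      have "solvable n ((card ?X + card ?Y) div 2 + 1) ?S"
      proof (rule less.hyps[OF _ r'])
        show "card ?X < card X" using ca True by simp
        show "mated n ?S (?X \<union> ?Y) ?Y" using xyz by (intro mated_merge[OF mY]) auto
        show "even (card ?X + card ?Y)" unfolding ca using True ev by presburger
      qed simp
      then show "solvable n ((card X - 2 + card Y) div 2 + 1) ?S"
        by (rule solvable_mono) (use ca True in simp_all)
    next
      fix x y
      let ?S = "{c \<in> S. c x \<noteq> c y}" and ?X = "X - {x, y}"
      assume xy: "x \<in> X" "y \<in> X" "x \<noteq> y" "x < n" "y < n"
        and r': "reduced n ?S 1 ?X Y (\<lambda>_. 0)" and ca: "card ?X = card X - 2"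
      have "solvable n ((card ?X + card Y) div 2 + 1) ?S"
      proof (rule less.hyps[OF _ r'])
        show "card ?X < card X" using ca True by simp
        show "mated n ?S (?X \<union> Y) Y" by (rule mated_mono[OF mY]) auto
        show "even (card ?X + card Y)" unfolding ca using True ev by presburger
        show "Y \<noteq> {} \<or> ?X = {..<n} \<or> (\<exists>u<n. \<exists>v<n. u \<notin> ?X \<and> v \<notin> ?X \<and> (\<forall>c\<in>?S. c u \<noteq> c v))"
          using xy by blast
      qed
      then show "solvable n ((card X - 2 + card Y) div 2 + 1) ?S" unfolding ca .
    qed
  next
    case False
    then have X2: "card X \<le> 2" by simp
    have rs: "reduced n S 3 Y {} (\<lambda>c. tally c X)" using reduced_rescale[OF red X2] by simp
    have lt: "\<And>x. x \<in> X \<union> Y \<Longrightarrow> x < n" and disj: "X \<inter> Y = {}" using red by (auto simp: reduced_def)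
    have step: "solvable n (card Y div 2) S'"
      if "S' \<subseteq> S" "even (card Y) \<Longrightarrow> \<exists>r. decides n S' (\<lambda>c. tally c X) r" for S'
    proof -
      have "mated n S' Y Y" using mY that(1) by (rule mated_mono) auto
      then have "solvable n ((card Y + card ({} :: nat set)) div 2) S'"
        using that(2) by (intro solvable_reduced[OF reduced_mono[OF rs that(1)]]) (auto simp: mated_def)
      then show ?thesis by simp
    qed
    consider "card X = 0" | "card X = 1" | "card X = 2" using X2 by linarith
    then show ?thesis
    proof cases
      case 1
      then have "decides n S (\<lambda>c. tally c X) None" using fin by (simp add: decides_def)
      then have "solvable n (card Y div 2) S" by (intro step) auto
      then show ?thesis by (rule solvable_mono) auto
    next
      case 2
      \<comment> \<open>By parity the number of groups is odd here.\<close>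
      then have "solvable n (card Y div 2) S" using ev by (intro step) auto
      then show ?thesis by (rule solvable_mono) auto
    next
      case 3
      then obtain x y where xy: "X = {x, y}" "x \<noteq> y" by (auto simp: card_2_iff)
      have xyn: "x < n" "y < n" "x \<notin> Y" "y \<notin> Y" using lt xy disj by auto
      have equal: "solvable n (card Y div 2) S'"
        if "S' \<subseteq> S" "\<And>c. c \<in> S' \<Longrightarrow> c x = c y" for S'
      proof -
        have "decides n S' (\<lambda>c. tally c X) (Some x)"
          unfolding decides_def using that(2) xy xyn by (auto simp: color_sign_def)
        then show ?thesis using that(1) by (intro step) auto
      qed
      have unequal: "solvable n (card Y div 2) S'"
        if "S' \<subseteq> S" "\<And>c. c \<in> S' \<Longrightarrow> c x \<noteq> c y" for S'
      proof -
        have "decides n S' (\<lambda>c. tally c X) None"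
          unfolding decides_def using that(2) xy xyn by (auto simp: color_sign_def)
        then show ?thesis using that(1) by (intro step) auto
      qed
      have "solvable n (Suc (Suc (card Y div 2))) S"
      proof (cases "Y = {}")
        case False
        \<comment> \<open>A group's ball and its mate form an equal pair against which
          \<open>x\<close> and then \<open>y\<close> are compared.\<close>
        then obtain v where v: "v \<in> Y" by blast
        with mY obtain u where u: "u < n" "u \<notin> X \<union> Y" "\<forall>c\<in>S. c u = c v" by (rule mated_obtain)
        have uv: "c u = c v" if "c \<in> S" for c using u(3) that by (rule bspec)
        have vn: "v < n" "u \<noteq> v" "u \<noteq> x" "u \<noteq> y" "v \<noteq> x" "v \<noteq> y" using v u(2) lt xy xyn by auto
        show ?thesis
        proof (rule solvable_compare[of u n v x])
          show "solvable n (Suc (card Y div 2)) {c \<in> S. c x = c u}"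
          proof (rule solvable_compare[of u n v y])
            show "solvable n (card Y div 2) {c \<in> {c \<in> S. c x = c u}. c y = c u}"
              by (rule equal) auto
            show "solvable n (card Y div 2) {c \<in> {c \<in> S. c x = c u}. c y \<noteq> c u}"
              by (rule unequal) auto
          qed (use u(1) vn xyn in \<open>auto dest: uv\<close>)
          show "solvable n (Suc (card Y div 2)) {c \<in> S. c x \<noteq> c u}"
          proof (rule solvable_compare[of u n v y])
            show "solvable n (card Y div 2) {c \<in> {c \<in> S. c x \<noteq> c u}. c y = c u}"
              by (rule unequal) auto
            show "solvable n (card Y div 2) {c \<in> {c \<in> S. c x \<noteq> c u}. c y \<noteq> c u}"
              by (rule equal) auto
          qed (use u(1) vn xyn in \<open>auto dest: uv\<close>)
        qed (use u(1) vn xyn in \<open>auto dest: uv\<close>)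
      next
        case True
        \<comment> \<open>Only two of at least four balls are left, so this is not the start and a
          discarded pair is available.\<close>
        have "X \<noteq> {..<n}" using 3 n by auto
        then have "\<exists>u<n. \<exists>v<n. u \<notin> X \<and> v \<notin> X \<and> (\<forall>c\<in>S. c u \<noteq> c v)"
          using less.prems(4) True by argo
        then obtain u v where uv: "u < n" "v < n" "u \<notin> X" "v \<notin> X" "\<forall>c\<in>S. c u \<noteq> c v"
          by (elim exE conjE) (rule that)
        have xv: "c x = c v" if "c \<in> {c \<in> S. c x \<noteq> c u}" for c
          using bspec[OF uv(5), of c] that by auto
        have yv: "c y = c v" if "c \<in> {c \<in> S. c y \<noteq> c u}" for c
          using bspec[OF uv(5), of c] that by auto
        have ne: "x \<noteq> v" "y \<noteq> v" "x \<noteq> u" "y \<noteq> u" using uv(3,4) xy by auto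
        show ?thesis
        \<comment> \<open>Unless this query relates \<open>x\<close> to \<open>y\<close> at once, it
          shows one of them to differ from \<open>u\<close>, hence to agree with
          \<open>v\<close>.\<close>
        proof (rule solvable_ask[of x n y u])
          have "solvable n (card Y div 2) {c \<in> S. c x = c y \<and> c y = c u}" by (rule equal) auto
          then show "solvable n (Suc (card Y div 2)) {c \<in> S. c x = c y \<and> c y = c u}"
            by (rule solvable_mono) auto
          have "solvable n (card Y div 2) {c \<in> S. c x \<noteq> c y}" by (rule unequal) auto
          then show "solvable n (Suc (card Y div 2)) {c \<in> S. c x \<noteq> c y}"
            by (rule solvable_mono) auto
          \<comment> \<open>Now \<open>x\<close> and \<open>v\<close> both differ from \<open>u\<close>, so they are mates.\<close>
          show "solvable n (Suc (card Y div 2)) {c \<in> S. c x \<noteq> c u}"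
          proof (rule solvable_compare[of x n v y])
            show "solvable n (card Y div 2) {c \<in> {c \<in> S. c x \<noteq> c u}. c y = c x}"
              by (rule equal) auto
            show "solvable n (card Y div 2) {c \<in> {c \<in> S. c x \<noteq> c u}. c y \<noteq> c x}"
              by (rule unequal) auto
            show "c x = c v" if "c \<in> {c \<in> S. c x \<noteq> c u}" for c using xv[OF that] .
          qed (use uv(2) xy(2) xyn ne in auto)
          show "solvable n (Suc (card Y div 2)) {c \<in> S. c y \<noteq> c u}"
          proof (rule solvable_compare[of y n v x])
            show "solvable n (card Y div 2) {c \<in> {c \<in> S. c y \<noteq> c u}. c x = c y}"
              by (rule equal) auto
            show "solvable n (card Y div 2) {c \<in> {c \<in> S. c y \<noteq> c u}. c x \<noteq> c y}"
              by (rule unequal) auto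
            show "c y = c v" if "c \<in> {c \<in> S. c y \<noteq> c u}" for c using yv[OF that] .
          qed (use uv(2) xy(2) xyn ne in auto)
        qed (use uv(1) xy(2) xyn ne in auto)
      qed
      then show ?thesis using 3 by simp
    qed
  qed
qed

section \<open>The exact value\<close>

lemma solvable_even:
  assumes "even n" "n \<ge> 4"
  shows "solvable n (n div 2 + 1) UNIV"
proof -
  have "solvable n ((card {..<n} + card ({} :: nat set)) div 2 + 1) UNIV"
    using assms by (intro solvable_reduced_unit) (auto simp: reduced_def mated_def)
  then show ?thesis by simp
qed

theorem theorem4p1:
  fixes n :: nat
  assumes "n \<ge> 3"
  shows "q3_pairing n = (if even n then n div 2 + 1 else n div 2)"
  unfolding q3_pairing_def
proof (rule Least_equality)
  have "n \<ge> 4" if "even n" using assms that by (cases "n = 3") auto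
  then have "solvable n (if even n then n div 2 + 1 else n div 2) UNIV"
    using solvable_even solvable_odd by simp
  then show "\<exists>t. solves_majority_within n (if even n then n div 2 + 1 else n div 2) t"
    by (simp only: solvable_UNIV_iff)
next
  fix k assume "\<exists>t. solves_majority_within n k t"
  then show "(if even n then n div 2 + 1 else n div 2) \<le> k"
    using solves_majority_lower_bound[of n k] assms by auto
qed

end
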